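(* Let $\langle A;\cdot,0,\Diamond\rangle$ be a monadic quasi-implication algebra. On $A\setminus\{0\}$ define $x\perp^M_A y$ iff $x\cdot(y\cdot 0)=1$, and $x R^M_A y$ iff $y\cdot\Diamond x=1$. Then $\langle A\setminus\{0\};\perp^M_A,R^M_A\rangle$ is a monadic orthoframe.
   Context: A quasi-implication algebra is a magma $\langle A;\cdot\rangle$ satisfying, for all $x,y,z$: (1) $(x\cdot y)\cdot x=x$; (2) $(x\cdot y)\cdot(x\cdot z)=(y\cdot x)\cdot(y\cdot z)$; (3) $((x\cdot y)\cdot(y\cdot x))\cdot x=((y\cdot x)\cdot(x\cdot y))\cdot y$. In any quasi-implication algebra $x\cdot x=y\cdot y$ for all $x,y$, and $1$ denotes this common element. A bounded quasi-implication algebra is a quasi-implication algebra with a distinguished element $0$ such that $0\cdot x=1$ for all $x$. A monadic quasi-implication algebra is an algebra $\langle A;\cdot,0,\Diamond\rangle$ such that $\langle A;\cdot,0\rangle$ is a bounded quasi-implication algebra and $\Diamond\colon A\to A$ satisfies, for all $x,y$: (a) $\Diamond\Diamond x\cdot\Diamond x=1$ and $x\cdot\Diamond x=1$; (b) $\Diamond(\Diamond x\cdot 0)=\Diamond x\cdot 0$ and $\Diamond 0=0$; (c) $\Diamond(((x\cdot 0)\cdot(y\cdot 0))\cdot x)=((\Diamond x\cdot 0)\cdot(\Diamond y\cdot 0))\cdot\Diamond x$. For a relation $R$ on a set $X$ and $U\subseteq X$, $R[U]=\{y\in X: uRy\text{ for some }u\in U\}$; for a relation $\perp$ on $X$, $U^{\perp}=\{y\in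 X: y\perp u\text{ for all }u\in U\}$. A monadic orthoframe is a triple $\langle X;\perp,R\rangle$ where $\perp$ is an irreflexive symmetric relation on $X$, $R$ is a reflexive transitive relation on $X$, and $R[R[\{x\}]^{\perp}]\subseteq R[\{x\}]^{\perp}$ for all $x\in X$. *)

theory Defs
  imports Main
begin

text \<open>The carrier of an algebra is the whole type \<open>'a\<close>. Frames, in contrast, carry an explicit
  carrier set, as the frame of an algebra lives on a proper subset of the algebra.\<close>

locale quasi_implication_algebra =
  fixes imp :: "'a \<Rightarrow> 'a \<Rightarrow> 'a"  (infixl "\<cdot>" 70)
  assumes imp_absorb: "(x \<cdot> y) \<cdot> x = x"
    and imp_exchange: "(x \<cdot> y) \<cdot> (x \<cdot> z) = (y \<cdot> x) \<cdot> (y \<cdot> z)"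
    and imp_join_commute: "((x \<cdot> y) \<cdot> (y \<cdot> x)) \<cdot> x = ((y \<cdot> x) \<cdot> (x \<cdot> y)) \<cdot> y"
begin

lemma imp_self_eq: "x \<cdot> x = y \<cdot> y"
  by (metis imp_absorb imp_join_commute)

definition one :: 'a  ("\<one>")
  where "\<one> = (THE e. \<forall>x. x \<cdot> x = e)"

lemma imp_self: "x \<cdot> x = \<one>"
proof -
  have "\<forall>y. y \<cdot> y = \<one>"
    unfolding one_def
  proof (rule theI)
    show "\<forall>y. y \<cdot> y = x \<cdot> x"
      using imp_self_eq by blast
    show "e = x \<cdot> x" if "\<forall>y. y \<cdot> y = e" for e
      using that by simp
  qed
  then show ?thesis ..
qed

end

locale bounded_quasi_implication_algebra = quasi_implication_algebra imp
  for imp :: "'a \<Rightarrow> 'a \<Rightarrow> 'a"  (infixl "\<cdot>" 70) +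
  fixes zero :: 'a  ("\<zero>")
  assumes zero_imp: "\<zero> \<cdot> x = \<one>"

locale monadic_quasi_implication_algebra = bounded_quasi_implication_algebra imp zero
  for imp :: "'a \<Rightarrow> 'a \<Rightarrow> 'a"  (infixl "\<cdot>" 70) and zero :: 'a  ("\<zero>") +
  fixes dia :: "'a \<Rightarrow> 'a"  ("\<diamond> _" [80] 80)
  assumes dia_dia_imp_dia: "\<diamond> \<diamond> x \<cdot> \<diamond> x = \<one>"
    and imp_dia: "x \<cdot> \<diamond> x = \<one>"
    and dia_compl_dia: "\<diamond> (\<diamond> x \<cdot> \<zero>) = \<diamond> x \<cdot> \<zero>"
    and dia_zero: "\<diamond> \<zero> = \<zero>"
    and dia_join: "\<diamond> (((x \<cdot> \<zero>) \<cdot> (y \<cdot> \<zero>)) \<cdot> x) = ((\<diamond> x \<cdot> \<zero>) \<cdot> (\<diamond> y \<cdot> \<zero>)) \<cdot> \<diamond> x"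
begin

definition frame_carrier :: "'a set"
  where "frame_carrier = UNIV - {\<zero>}"

definition frame_perp :: "('a \<times> 'a) set"
  where "frame_perp = {(x, y) \<in> frame_carrier \<times> frame_carrier. x \<cdot> (y \<cdot> \<zero>) = \<one>}"

definition frame_rel :: "('a \<times> 'a) set"
  where "frame_rel = {(x, y) \<in> frame_carrier \<times> frame_carrier. y \<cdot> \<diamond> x = \<one>}"

end

definition perp_set :: "'x set \<Rightarrow> ('x \<times> 'x) set \<Rightarrow> 'x set \<Rightarrow> 'x set"
  where "perp_set X P U = {y \<in> X. \<forall>u\<in>U. (y, u) \<in> P}"

text \<open>For a relation \<open>R\<close> on \<open>X\<close>, the set \<open>R[U]\<close> is the library's relational image \<open>R `` U\<close>.\<close>

definition monadic_orthoframe :: "'x set \<Rightarrow> ('x \<times> 'x) set \<Rightarrow> ('x \<times> 'x) set \<Rightarrow> bool"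
  where "monadic_orthoframe X P R \<longleftrightarrow>
    P \<subseteq> X \<times> X \<and> irrefl P \<and> sym P \<and>
    R \<subseteq> X \<times> X \<and> refl_on X R \<and> trans R \<and>
    (\<forall>x\<in>X. R `` perp_set X P (R `` {x}) \<subseteq> perp_set X P (R `` {x}))"

end

theory Submission
  imports Defs
begin

text \<open>Read \<open>x \<cdot> y = \<one>\<close> as \<open>x \<le> y\<close> and \<open>x \<cdot> \<zero>\<close> as the orthocomplement \<open>x'\<close>. This gives an ordered set
  with an antitone involution in which \<open>x \<le> x'\<close> forces \<open>x = \<zero>\<close>, and \<open>((x' \<cdot> y') \<cdot> x)\<close> plays the
  role of the join, so that \<open>\<diamond>\<close> is a monotone closure operator whose closed elements are closed under
  complement. If \<open>y\<close> is orthogonal to everything below \<open>\<diamond>x\<close>, then \<open>y \<le> (\<diamond>x)'\<close>,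
  hence \<open>\<diamond>y \<le> \<diamond>((\<diamond>x)') = (\<diamond>x)'\<close>, and every \<open>z \<le> \<diamond>y\<close> is again orthogonal to
  everything below \<open>\<diamond>x\<close>.\<close>

context quasi_implication_algebra
begin

lemma one_imp: "\<one> \<cdot> x = x"
  using imp_absorb[of x x] by (simp add: imp_self)

lemma imp_one: "x \<cdot> \<one> = \<one>"
  using imp_exchange[of x "\<one>" "\<one>"] by (simp add: imp_self one_imp)

lemma imp_trans: "x \<cdot> z = \<one>" if "x \<cdot> y = \<one>" "y \<cdot> z = \<one>"
  using imp_exchange[of x y z] by (simp add: that imp_one one_imp)

lemma imp_imp_self: "x \<cdot> (x \<cdot> y) = x \<cdot> y"
  using imp_absorb[of "x \<cdot> y" x] by (simp add: imp_absorb)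

text \<open>Exchange turns the left side into \<open>p \<cdot> p\<close> with
  \<open>p = y \<cdot> x\<close>. Comparability of \<open>x\<close> and \<open>y\<close> stands in
  for the classical weakening law.\<close>

lemma imp_weaken: "x \<cdot> (y \<cdot> x) = \<one>" if "x \<cdot> y = \<one>"
proof -
  have "x \<cdot> (y \<cdot> x) = (x \<cdot> y) \<cdot> (x \<cdot> (y \<cdot> x))"
    by (simp add: that one_imp)
  also have "\<dots> = (y \<cdot> x) \<cdot> (y \<cdot> (y \<cdot> x))"
    by (rule imp_exchange)
  finally show ?thesis
    by (simp add: imp_imp_self imp_self)
qed

end

context bounded_quasi_implication_algebra
begin

lemma compl_compl: "(x \<cdot> \<zero>) \<cdot> \<zero> = x"
  using imp_join_commute[of x \<zero>] by (simp add: zero_imp imp_one one_imp)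

lemma compl_imp: "(x \<cdot> \<zero>) \<cdot> (x \<cdot> y) = \<one>"
  using imp_exchange[of x \<zero> y] by (simp add: zero_imp imp_self)

lemma compl_antitone: "(y \<cdot> \<zero>) \<cdot> (x \<cdot> \<zero>) = \<one>" if "x \<cdot> y = \<one>"
proof -
  \<comment> \<open>As \<open>y \<cdot> \<zero>\<close> lies below \<open>y \<cdot> x\<close>,
    weakening puts it below this product.\<close>
  have "x \<cdot> \<zero> = (y \<cdot> x) \<cdot> (y \<cdot> \<zero>)"
    using imp_exchange[of x y \<zero>] by (simp add: that one_imp)
  then show ?thesis
    by (simp add: imp_weaken compl_imp)
qed

lemma imp_compl_swap: "y \<cdot> (x \<cdot> \<zero>) = \<one>" if "x \<cdot> (y \<cdot> \<zero>) = \<one>"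
  using compl_antitone[OF that] by (simp add: compl_compl)

lemma imp_compl_self_eq_zero: "x = \<zero>" if "x \<cdot> (x \<cdot> \<zero>) = \<one>"
  using that compl_compl[of x] by (simp add: imp_imp_self one_imp)

lemma imp_zero_eq_zero: "x = \<zero>" if "x \<cdot> \<zero> = \<one>"
  using that compl_compl[of x] by (simp add: one_imp)

lemma imp_join: "x \<cdot> (((x \<cdot> \<zero>) \<cdot> (y \<cdot> \<zero>)) \<cdot> x) = \<one>"
  using compl_imp[of "x \<cdot> \<zero>" "y \<cdot> \<zero>"] by (simp add: imp_weaken compl_compl)

text \<open>Exchange on complements makes the join symmetric in \<open>x\<close> and
  \<open>y\<close>; the swapped form collapses to \<open>\<one> \<cdot> y\<close>.\<close>

lemma join_absorb: "((x \<cdot> \<zero>) \<cdot> (y \<cdot> \<zero>)) \<cdot> x = y" if "x \<cdot> y = \<one>"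
  using imp_exchange[of "x \<cdot> \<zero>" "y \<cdot> \<zero>" \<zero>] compl_antitone[OF that]
  by (simp add: compl_compl one_imp)

end

context monadic_quasi_implication_algebra
begin

text \<open>For \<open>x\<close> below \<open>y\<close> the join is \<open>y\<close>, so
  \<open>dia_join\<close> presents \<open>\<diamond> y\<close> as a join with
  \<open>\<diamond> x\<close>.\<close>

lemma dia_mono: "\<diamond> x \<cdot> \<diamond> y = \<one>" if "x \<cdot> y = \<one>"
  using imp_join[of "\<diamond> x" "\<diamond> y"] by (simp only: dia_join[symmetric] join_absorb[OF that])

lemma dia_closure: "x \<cdot> \<diamond> y = \<one>" if "x \<cdot> \<diamond> y' = \<one>" "y' \<cdot> \<diamond> y = \<one>"
  using imp_trans[OF that(1) imp_trans[OF dia_mono[OF that(2)] dia_dia_imp_dia]] .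

lemma dia_eq_zero: "x = \<zero>" if "\<diamond> x = \<zero>"
  using imp_dia[of x] that imp_zero_eq_zero by simp

lemma frame_rel_image_perp_subset:
  assumes "x \<in> frame_carrier"
  defines "U \<equiv> perp_set frame_carrier frame_perp (frame_rel `` {x})"
  shows "frame_rel `` U \<subseteq> U"
proof
  fix z assume "z \<in> frame_rel `` U"
  then obtain y where y: "y \<in> U" and z: "z \<in> frame_carrier" "z \<cdot> \<diamond> y = \<one>"
    by (auto simp: frame_rel_def)
  \<comment> \<open>\<open>\<diamond> x\<close> is the largest successor of \<open>x\<close>, so
    orthogonality to it is the strongest condition.\<close>
  have "\<diamond> x \<in> frame_rel `` {x}"
    using assms(1) dia_eq_zero by (auto simp: frame_rel_def frame_carrier_def imp_self)
  then have "y \<cdot> (\<diamond> x \<cdot> \<zero>) = \<one>"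
    using y by (auto simp: U_def perp_set_def frame_perp_def)
  then have "\<diamond> y \<cdot> (\<diamond> x \<cdot> \<zero>) = \<one>"
    using dia_mono[of y "\<diamond> x \<cdot> \<zero>"] by (simp only: dia_compl_dia)
  then have z_le: "z \<cdot> (\<diamond> x \<cdot> \<zero>) = \<one>"
    by (rule imp_trans[OF z(2)])
  have "z \<cdot> (u \<cdot> \<zero>) = \<one>" if "u \<cdot> \<diamond> x = \<one>" for u
    using imp_trans[OF z_le compl_antitone[OF that]] .
  then show "z \<in> U"
    using z(1) by (auto simp: U_def perp_set_def frame_perp_def frame_rel_def)
qed

lemma monadic_orthoframe_frame: "monadic_orthoframe frame_carrier frame_perp frame_rel"
  unfolding monadic_orthoframe_def
proof (intro conjI)
  show "frame_perp \<subseteq> frame_carrier \<times> frame_carrier" "frame_rel \<subseteq> frame_carrier \<times> frame_carrier"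
    by (auto simp: frame_perp_def frame_rel_def)
  show "irrefl frame_perp"
    using imp_compl_self_eq_zero by (auto simp: irrefl_def frame_perp_def frame_carrier_def)
  show "sym frame_perp"
    using imp_compl_swap by (auto simp: sym_def frame_perp_def)
  show "refl_on frame_carrier frame_rel"
    by (auto simp: refl_on_def frame_rel_def imp_dia)
  show "trans frame_rel"
    using dia_closure by (auto simp: trans_def frame_rel_def)
  show "\<forall>x\<in>frame_carrier. frame_rel `` perp_set frame_carrier frame_perp (frame_rel `` {x})
      \<subseteq> perp_set frame_carrier frame_perp (frame_rel `` {x})"
    using frame_rel_image_perp_subset by blast
qed

end

theorem theorem5p7:
  fixes imp :: "'a \<Rightarrow> 'a \<Rightarrow> 'a" and zero :: 'a and dia :: "'a \<Rightarrow> 'a"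
  assumes "monadic_quasi_implication_algebra imp zero dia"
  shows "monadic_orthoframe
    (monadic_quasi_implication_algebra.frame_carrier zero)
    (monadic_quasi_implication_algebra.frame_perp imp zero)
    (monadic_quasi_implication_algebra.frame_rel imp zero dia)"
  using assms by (rule monadic_quasi_implication_algebra.monadic_orthoframe_frame)

end
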